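(* Let $A\subseteq\mathbb{R}$ and let $f:A\times A\to\mathbb{R}$ be a factorable double function. If $f$ preserves factorable double quasi-Cauchy sequences from $A\times A$, then $f$ is continuous on $A\times A$.
   Context: A function $f:A\times A\to\mathbb{R}$ is called factorable if there are functions $g,h:A\to\mathbb{R}$ with $f(x,y)=g(x)h(y)$ for all $x,y\in A$. A double sequence is a family indexed by $(k,l)\in\mathbb{N}\times\mathbb{N}$, where $\mathbb{N}=\{1,2,3,\dots\}$. A double sequence $\{z_{k,l}\}$ in $\mathbb{R}$ or in $\mathbb{R}^2$ is quasi-Cauchy if for every $\epsilon>0$ there is $N\in\mathbb{N}$ such that $\max_{r,s\in\{0,1\}}|z_{k,l}-z_{k+r,l+s}|<\epsilon$ whenever $k,l>N$; here $|\cdot|$ is the absolute value on $\mathbb{R}$ or the Euclidean norm on $\mathbb{R}^2$. A double sequence $\{z_{k,l}\}$ of points of $A\times A$ is factorable if there are single sequences $\{x_k\}$ and $\{y_l\}$ in $A$ with $z_{k,l}=(x_k,y_l)$ for all $k,l$. The function $f$ preserves factorable double quasi-Cauchy sequences from $A\times A$ if, for every factorable quasi-Cauchy double sequence $\{z_{k,l}\}$ of points of $A\times A$, the real double sequence $\{f(z_{k,l})\}$ is quasi-Cauchy. *)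

theory Defs
  imports "HOL-Analysis.Analysis"
begin

text \<open>
  Double sequences are indexed by pairs of positive integers. They are represented by functions
  on all natural numbers, whose values at index 0 are never looked at. Functions on
  a set \<open>A \<times> A\<close> are likewise represented by total functions on pairs, and only their values on
  \<open>A \<times> A\<close> matter.
\<close>

definition factorable_fun :: "'a set \<Rightarrow> ('a \<times> 'a \<Rightarrow> real) \<Rightarrow> bool" where
  "factorable_fun A f \<longleftrightarrow>
     (\<exists>g h :: 'a \<Rightarrow> real. \<forall>x\<in>A. \<forall>y\<in>A. f (x, y) = g x * h y)"

text \<open>
  Used below at the types \<open>real\<close> and \<open>real \<times> real\<close>; the library norm on the latter is
  the Euclidean one.
\<close>

definition double_quasi_Cauchy :: "(nat \<Rightarrow> nat \<Rightarrow> 'a::real_normed_vector) \<Rightarrow> bool" where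
  "double_quasi_Cauchy z \<longleftrightarrow>
     (\<forall>\<epsilon>>0. \<exists>N\<ge>1. \<forall>k l. k > N \<and> l > N \<longrightarrow>
        (MAX (r, s)\<in>{0, 1} \<times> {0, 1}. norm (z k l - z (k + r) (l + s))) < \<epsilon>)"

definition factorable_double_seq :: "'a set \<Rightarrow> (nat \<Rightarrow> nat \<Rightarrow> 'a \<times> 'a) \<Rightarrow> bool" where
  "factorable_double_seq A z \<longleftrightarrow>
     (\<exists>x y. (\<forall>k\<ge>1. x k \<in> A) \<and> (\<forall>l\<ge>1. y l \<in> A) \<and> (\<forall>k\<ge>1. \<forall>l\<ge>1. z k l = (x k, y l)))"

definition preserves_factorable_double_quasi_Cauchy ::
    "'a::real_normed_vector set \<Rightarrow> ('a \<times> 'a \<Rightarrow> real) \<Rightarrow> bool" where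
  "preserves_factorable_double_quasi_Cauchy A f \<longleftrightarrow>
     (\<forall>z. factorable_double_seq A z \<and> double_quasi_Cauchy z \<longrightarrow>
        double_quasi_Cauchy (\<lambda>k l. f (z k l)))"

end

theory Submission
  imports Defs "HOL-Probability.Characteristic_Functions"
begin

text \<open>
  Continuity at \<open>(a, b)\<close> is tested on sequences. If \<open>u n\<close> in \<open>A \<times> A\<close> tends to \<open>(a, b)\<close>, the sequence
  \<open>w = (a, b), u 0, (a, b), u 1, \<dots>\<close> still tends to \<open>(a, b)\<close>, so both coordinates of \<open>w\<close> are
  Cauchy and the factorable double sequence \<open>(fst (w k), snd (w l))\<close> that they generate is
  quasi-Cauchy (\<open>double_quasi_Cauchy_Pair\<close>). Its diagonal is \<open>w\<close> itself. The image
  under \<open>f\<close> is quasi-Cauchy as well, and the shift \<open>r = s = 1\<close> along the diagonal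
  (\<open>double_quasi_Cauchy_diagonal\<close>) shows that consecutive values of \<open>f\<close> along \<open>w\<close> get arbitrarily
  close. Every second such difference is \<open>f (a, b) - f (u n)\<close>, hence \<open>f (u n)\<close> tends to \<open>f (a, b)\<close>.
\<close>

lemma double_quasi_Cauchy_iff:
  "double_quasi_Cauchy z \<longleftrightarrow>
     (\<forall>\<epsilon>>0. \<exists>N\<ge>1. \<forall>k l. k > N \<and> l > N \<longrightarrow>
        (\<forall>r\<in>{0, 1}. \<forall>s\<in>{0, 1}. norm (z k l - z (k + r) (l + s)) < \<epsilon>))"
  unfolding double_quasi_Cauchy_def by (subst Max_less_iff) auto

lemma double_quasi_Cauchy_Pair:
  fixes x :: "nat \<Rightarrow> 'a::real_normed_vector" and y :: "nat \<Rightarrow> 'b::real_normed_vector"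
  assumes "Cauchy x" and "Cauchy y"
  shows "double_quasi_Cauchy (\<lambda>k l. (x k, y l))"
  unfolding double_quasi_Cauchy_iff
proof (intro allI impI)
  fix \<epsilon> :: real
  assume "\<epsilon> > 0"
  then have half: "\<epsilon> / 2 > 0"
    by simp
  obtain M where M: "norm (x m - x n) < \<epsilon> / 2" if "m \<ge> M" "n \<ge> M" for m n
    using CauchyD[OF assms(1) half] by blast
  obtain M' where M': "norm (y m - y n) < \<epsilon> / 2" if "m \<ge> M'" "n \<ge> M'" for m n
    using CauchyD[OF assms(2) half] by blast
  have "norm ((x k, y l) - (x (k + r), y (l + s))) < \<epsilon>"
    if "k > max 1 (max M M')" "l > max 1 (max M M')" for k l r s
  proof -
    have "norm ((x k, y l) - (x (k + r), y (l + s)))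
        \<le> norm (x k - x (k + r)) + norm (y l - y (l + s))"
      by (simp add: norm_Pair_le)
    also have "\<dots> < \<epsilon>"
      using M[of k "k + r"] M'[of l "l + s"] that by simp
    finally show ?thesis .
  qed
  then show "\<exists>N\<ge>1. \<forall>k l. k > N \<and> l > N \<longrightarrow>
      (\<forall>r\<in>{0, 1}. \<forall>s\<in>{0, 1}. norm ((x k, y l) - (x (k + r), y (l + s))) < \<epsilon>)"
    by (intro exI[of _ "max 1 (max M M')"]) simp
qed

lemma double_quasi_Cauchy_diagonal:
  assumes "double_quasi_Cauchy z"
  shows "(\<lambda>n. z n n - z (Suc n) (Suc n)) \<longlonglongrightarrow> 0"
proof (rule LIMSEQ_I)
  fix \<epsilon> :: real
  assume "\<epsilon> > 0"
  then obtain N where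
    N: "\<forall>k l. k > N \<and> l > N \<longrightarrow>
        (\<forall>r\<in>{0, 1}. \<forall>s\<in>{0, 1}. norm (z k l - z (k + r) (l + s)) < \<epsilon>)"
    using assms unfolding double_quasi_Cauchy_iff by blast
  have "norm (z n n - z (Suc n) (Suc n) - 0) < \<epsilon>" if "n \<ge> Suc N" for n
    using N[rule_format, of n n 1 1] that by simp
  then show "\<exists>no. \<forall>n\<ge>no. norm (z n n - z (Suc n) (Suc n) - 0) < \<epsilon>"
    by blast
qed

lemma preserves_factorable_double_quasi_Cauchy_continuous_on:
  fixes A :: "'a::real_normed_vector set"
  assumes pres: "preserves_factorable_double_quasi_Cauchy A f"
  shows "continuous_on (A \<times> A) f"
proof (rule continuous_on_sequentiallyI)
  fix u :: "nat \<Rightarrow> 'a \<times> 'a" and c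
  assume u: "\<forall>n. u n \<in> A \<times> A" and c: "c \<in> A \<times> A" and lim: "u \<longlonglongrightarrow> c"
  define w where "w n = (if even n then c else u (n div 2))" for n
  have w_in: "w n \<in> A \<times> A" for n
    using u c by (simp add: w_def)
  have "w \<longlonglongrightarrow> c"
    by (rule limseq_even_odd) (simp_all add: w_def lim)
  then have "Cauchy (\<lambda>n. fst (w n))" "Cauchy (\<lambda>n. snd (w n))"
    by (auto intro!: LIMSEQ_imp_Cauchy tendsto_fst tendsto_snd)
  then have "double_quasi_Cauchy (\<lambda>k l. (fst (w k), snd (w l)))"
    by (rule double_quasi_Cauchy_Pair)
  moreover have "factorable_double_seq A (\<lambda>k l. (fst (w k), snd (w l)))"
    unfolding factorable_double_seq_def
    using w_in
    by (intro exI[of _ "\<lambda>k. fst (w k)"] exI[of _ "\<lambda>l. snd (w l)"]) (simp add: mem_Times_iff)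
  ultimately have "double_quasi_Cauchy (\<lambda>k l. f (fst (w k), snd (w l)))"
    using pres unfolding preserves_factorable_double_quasi_Cauchy_def by blast
  from double_quasi_Cauchy_diagonal[OF this]
  have "(\<lambda>n. f (w n) - f (w (Suc n))) \<longlonglongrightarrow> 0"
    by simp
  then have "(\<lambda>n. f (w (2 * n)) - f (w (Suc (2 * n)))) \<longlonglongrightarrow> 0"
    by (rule LIMSEQ_subseq_LIMSEQ[unfolded o_def]) (simp add: strict_mono_def)
  then have "(\<lambda>n. f c - f (u n)) \<longlonglongrightarrow> 0"
    by (simp add: w_def)
  from tendsto_diff[OF tendsto_const[of "f c"] this]
  show "(\<lambda>n. f (u n)) \<longlonglongrightarrow> f c"
    by simp
qed

theorem theorem3p2:
  fixes A :: "real set" and f :: "real \<times> real \<Rightarrow> real"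
  assumes "factorable_fun A f"
    and "preserves_factorable_double_quasi_Cauchy A f"
  shows "continuous_on (A \<times> A) f"
  using assms(2) by (rule preserves_factorable_double_quasi_Cauchy_continuous_on)

end
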